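(* Let $\mathfrak g$ and $\mathfrak h$ be Leibniz algebras, let $l,r:\mathfrak g\to\mathfrak{gl}(\mathfrak h)$ be linear maps and $\omega\in\mathrm{Hom}(\otimes^2\mathfrak g,\mathfrak h)$. The following two statements are equivalent: (a) $(\mathfrak g\oplus\mathfrak h,[\cdot,\cdot]_{(l,r,\omega)})$ is a Leibniz algebra, which is a non-abelian extension of $\mathfrak g$ by $\mathfrak h$; (b) $l+r+\omega$ is a Maurer–Cartan element of the DGLA $L$, i.e. $\omega+l+r\in MC(L)$.
   Context: All vector spaces are over a fixed ground field of characteristic different from 2. A (left) Leibniz algebra is a vector space with a bilinear bracket satisfying $[x,[y,z]]=[[x,y],z]+[y,[x,z]]$. The bracket $[\cdot,\cdot]_{(l,r,\omega)}$ on $\mathfrak g\oplus\mathfrak h$ is $[x+\alpha,y+\beta]_{(l,r,\omega)}=[x,y]_{\mathfrak g}+\omega(x,y)+l_x\beta+r_y\alpha+[\alpha,\beta]_{\mathfrak h}$ for $x,y\in\mathfrak g$, $\alpha,\beta\in\mathfrak h$. A non-abelian extension of $\mathfrak g$ by $\mathfrak h$ is a short exact sequence of Leibniz algebras $0\to\mathfrak h\to\hat{\mathfrak g}\to\mathfrak g\to0$; for $\hat{\mathfrak g}=\mathfrak g\oplus\mathfrak h$ the maps are the inclusion and the projection. The DGLA $L$: for a vector space $E$ put $C^k(E,E)=\mathrm{Hom}(\otimes^{k+1}E,E)$, $k\ge0$. For $P\in C^p(E,E)$, $Q\in C^q(E,E)$, $P\circ Q\in C^{p+q}(E,E)$ is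 $$P\circ Q(x_1,\dots,x_{p+q+1})=\sum_{k=0}^p(-1)^{kq}\sum_{\sigma\in sh(k,q)}\mathrm{sgn}(\sigma)P(x_{\sigma(1)},\dots,x_{\sigma(k)},Q(x_{\sigma(k+1)},\dots,x_{\sigma(k+q)},x_{k+q+1}),x_{k+q+2},\dots,x_{p+q+1}),$$ where $sh(k,q)$ is the set of $(k,q)$-shuffles, and $[P,Q]_C=P\circ Q+(-1)^{pq+1}Q\circ P$. Let $E=\mathfrak g\oplus\mathfrak h$ be the direct sum Leibniz algebra, with bracket $\mu(x+\alpha,y+\beta)=[x,y]_{\mathfrak g}+[\alpha,\beta]_{\mathfrak h}$, and $\overline\partial P=[\mu,P]_C$. Then $(C(E,E),[\cdot,\cdot]_C,\overline\partial)$ is a DGLA. Let $L_k=C^k_>(\mathfrak g\oplus\mathfrak h,\mathfrak h)$ be the space of those $P\in\mathrm{Hom}(\otimes^{k+1}(\mathfrak g\oplus\mathfrak h),\mathfrak h)$ vanishing on $\otimes^{k+1}\mathfrak h$. $L=\oplus_kL_k$ is a sub-DGLA, with $L_1=\mathrm{Hom}(\otimes^2\mathfrak g,\mathfrak h)\oplus\mathrm{Hom}(\mathfrak g\otimes\mathfrak h,\mathfrak h)\oplus\mathrm{Hom}(\mathfrak h\otimes\mathfrak g,\mathfrak h)$. $MC(L)=\{c\in L_1:\overline\partial c+\tfrac12[c,c]_C=0\}$. Linear maps $l,r:\mathfrak g\to\mathfrak{gl}(\mathfrak h)$ are viewed as elements of $\mathrm{Hom}(\mathfrak g\otimes\mathfrak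 h,\mathfrak h)$ and $\mathrm{Hom}(\mathfrak h\otimes\mathfrak g,\mathfrak h)$ via $l(x,\alpha)=l_x(\alpha)$, $r(\alpha,x)=r_x(\alpha)$. *)

theory Defs
  imports "HOL-Analysis.Product_Vector" "HOL-Combinatorics.Permutations"
    "HOL-Computational_Algebra.Computational_Algebra"
begin

text \<open>
  Vector spaces are types of class \<open>ab_group_add\<close> with an explicit scalar multiplication, subject
  to the library locale \<open>vector_space\<close>.  No finiteness of dimension is assumed.
\<close>

subsection \<open>Leibniz algebras and their extensions\<close>

definition bilinear_map ::
  "('k::field \<Rightarrow> 'a::ab_group_add \<Rightarrow> 'a) \<Rightarrow> ('k \<Rightarrow> 'b::ab_group_add \<Rightarrow> 'b) \<Rightarrow>
   ('k \<Rightarrow> 'c::ab_group_add \<Rightarrow> 'c) \<Rightarrow> ('a \<Rightarrow> 'b \<Rightarrow> 'c) \<Rightarrow> bool" where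
  "bilinear_map s1 s2 s3 B \<longleftrightarrow>
     (\<forall>x. Vector_Spaces.linear s2 s3 (B x)) \<and> (\<forall>y. Vector_Spaces.linear s1 s3 (\<lambda>x. B x y))"

locale leibniz_algebra = vector_space scale
  for scale :: "'k::field \<Rightarrow> 'a::ab_group_add \<Rightarrow> 'a" +
  fixes bracket :: "'a \<Rightarrow> 'a \<Rightarrow> 'a"
  assumes bilinear_bracket: "bilinear_map scale scale scale bracket"
    and left_leibniz:
      "bracket x (bracket y z) = bracket (bracket x y) z + bracket y (bracket x z)"

definition leibniz_hom ::
  "('k::field \<Rightarrow> 'a::ab_group_add \<Rightarrow> 'a) \<Rightarrow> ('a \<Rightarrow> 'a \<Rightarrow> 'a) \<Rightarrow>
   ('k \<Rightarrow> 'b::ab_group_add \<Rightarrow> 'b) \<Rightarrow> ('b \<Rightarrow> 'b \<Rightarrow> 'b) \<Rightarrow> ('a \<Rightarrow> 'b) \<Rightarrow> bool" where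
  "leibniz_hom s1 b1 s2 b2 f \<longleftrightarrow>
     Vector_Spaces.linear s1 s2 f \<and> (\<forall>x y. f (b1 x y) = b2 (f x) (f y))"

text \<open>
  \<open>nonabelian_extension sg bg sh bh se be i p\<close>: the sequence
  \<open>0 \<rightarrow> h \<rightarrow> e \<rightarrow> g \<rightarrow> 0\<close> with maps \<open>i\<close> and \<open>p\<close> is a short exact sequence of Leibniz algebras.
\<close>

definition nonabelian_extension ::
  "('k::field \<Rightarrow> 'g::ab_group_add \<Rightarrow> 'g) \<Rightarrow> ('g \<Rightarrow> 'g \<Rightarrow> 'g) \<Rightarrow>
   ('k \<Rightarrow> 'h::ab_group_add \<Rightarrow> 'h) \<Rightarrow> ('h \<Rightarrow> 'h \<Rightarrow> 'h) \<Rightarrow>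
   ('k \<Rightarrow> 'e::ab_group_add \<Rightarrow> 'e) \<Rightarrow> ('e \<Rightarrow> 'e \<Rightarrow> 'e) \<Rightarrow> ('h \<Rightarrow> 'e) \<Rightarrow> ('e \<Rightarrow> 'g) \<Rightarrow> bool" where
  "nonabelian_extension sg bg sh bh se be i p \<longleftrightarrow>
     leibniz_algebra sg bg \<and> leibniz_algebra sh bh \<and> leibniz_algebra se be \<and>
     leibniz_hom sh bh se be i \<and> leibniz_hom se be sg bg p \<and>
     inj i \<and> range i = {e. p e = 0} \<and> surj p"

abbreviation prod_scale ::
  "('k::field \<Rightarrow> 'g::ab_group_add \<Rightarrow> 'g) \<Rightarrow> ('k \<Rightarrow> 'h::ab_group_add \<Rightarrow> 'h) \<Rightarrow>
   'k \<Rightarrow> 'g \<times> 'h \<Rightarrow> 'g \<times> 'h" where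
  "prod_scale \<equiv> module_prod.scale"

definition ext_bracket ::
  "('g::ab_group_add \<Rightarrow> 'g \<Rightarrow> 'g) \<Rightarrow> ('h::ab_group_add \<Rightarrow> 'h \<Rightarrow> 'h) \<Rightarrow>
   ('g \<Rightarrow> 'h \<Rightarrow> 'h) \<Rightarrow> ('g \<Rightarrow> 'h \<Rightarrow> 'h) \<Rightarrow> ('g \<Rightarrow> 'g \<Rightarrow> 'h) \<Rightarrow>
   'g \<times> 'h \<Rightarrow> 'g \<times> 'h \<Rightarrow> 'g \<times> 'h" where
  "ext_bracket bg bh l r \<omega> = (\<lambda>(x, \<alpha>) (y, \<beta>). (bg x y, \<omega> x y + l x \<beta> + r y \<alpha> + bh \<alpha> \<beta>))"

subsection \<open>The graded Lie bracket on cochains\<close>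

text \<open>
  An element of \<open>Hom(\<otimes>\<^sup>k\<^sup>+\<^sup>1 E, E)\<close> is a multilinear function of argument lists of length \<open>k + 1\<close>.  It is
  set to \<open>0\<close> on all other lists, so that equality of cochains is equality of functions.
\<close>

definition cochains :: "('k::field \<Rightarrow> 'e::ab_group_add \<Rightarrow> 'e) \<Rightarrow> nat \<Rightarrow> ('e list \<Rightarrow> 'e) set" where
  "cochains s k = {P.
     (\<forall>xs. length xs = k + 1 \<longrightarrow>
        (\<forall>i<k + 1. Vector_Spaces.linear s s (\<lambda>x. P (xs[i := x])))) \<and>
     (\<forall>xs. length xs \<noteq> k + 1 \<longrightarrow> P xs = 0)}"

text \<open>Shuffles permute the indices \<open>0, \<dots>, k + q - 1\<close>; list positions also start from \<open>0\<close>.\<close>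

definition shuffle_perms :: "nat \<Rightarrow> nat \<Rightarrow> (nat \<Rightarrow> nat) set" where
  "shuffle_perms k q = {\<sigma>. \<sigma> permutes {..<k + q} \<and>
     strict_mono_on {..<k} \<sigma> \<and> strict_mono_on {k..<k + q} \<sigma>}"

text \<open>In the next two definitions \<open>p\<close> and \<open>q\<close> are the degrees of \<open>P\<close> and \<open>Q\<close>.\<close>

definition circ_C ::
  "('k::field \<Rightarrow> 'e::ab_group_add \<Rightarrow> 'e) \<Rightarrow> nat \<Rightarrow> nat \<Rightarrow>
   ('e list \<Rightarrow> 'e) \<Rightarrow> ('e list \<Rightarrow> 'e) \<Rightarrow> 'e list \<Rightarrow> 'e" where
  "circ_C s p q P Q = (\<lambda>xs. if length xs = p + q + 1 then
     \<Sum>k=0..p. s ((-1) ^ (k * q)) (\<Sum>\<sigma>\<in>shuffle_perms k q. s (of_int (sign \<sigma>))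
       (P (map (\<lambda>i. xs ! \<sigma> i) [0..<k]
           @ [Q (map (\<lambda>i. xs ! \<sigma> i) [k..<k + q] @ [xs ! (k + q)])]
           @ drop (k + q + 1) xs)))
     else 0)"

definition bracket_C ::
  "('k::field \<Rightarrow> 'e::ab_group_add \<Rightarrow> 'e) \<Rightarrow> nat \<Rightarrow> nat \<Rightarrow>
   ('e list \<Rightarrow> 'e) \<Rightarrow> ('e list \<Rightarrow> 'e) \<Rightarrow> 'e list \<Rightarrow> 'e" where
  "bracket_C s p q P Q =
     (\<lambda>xs. circ_C s p q P Q xs + s ((-1) ^ (p * q + 1)) (circ_C s q p Q P xs))"

subsection \<open>The DGLA of cochains with values in the second summand\<close>

definition cochain_of_binop :: "('e \<Rightarrow> 'e \<Rightarrow> 'e::ab_group_add) \<Rightarrow> 'e list \<Rightarrow> 'e" where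
  "cochain_of_binop B = (\<lambda>xs. case xs of [u, v] \<Rightarrow> B u v | _ \<Rightarrow> 0)"

definition mu_cochain ::
  "('g::ab_group_add \<Rightarrow> 'g \<Rightarrow> 'g) \<Rightarrow> ('h::ab_group_add \<Rightarrow> 'h \<Rightarrow> 'h) \<Rightarrow>
   ('g \<times> 'h) list \<Rightarrow> 'g \<times> 'h" where
  "mu_cochain bg bh = cochain_of_binop (\<lambda>(x, \<alpha>) (y, \<beta>). (bg x y, bh \<alpha> \<beta>))"

text \<open>The differential on cochains of degree \<open>k\<close>; \<open>\<mu>\<close> has degree \<open>1\<close>.\<close>

definition dbar ::
  "('k::field \<Rightarrow> 'g::ab_group_add \<Rightarrow> 'g) \<Rightarrow> ('g \<Rightarrow> 'g \<Rightarrow> 'g) \<Rightarrow>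
   ('k \<Rightarrow> 'h::ab_group_add \<Rightarrow> 'h) \<Rightarrow> ('h \<Rightarrow> 'h \<Rightarrow> 'h) \<Rightarrow>
   nat \<Rightarrow> (('g \<times> 'h) list \<Rightarrow> 'g \<times> 'h) \<Rightarrow> ('g \<times> 'h) list \<Rightarrow> 'g \<times> 'h" where
  "dbar sg bg sh bh k P = bracket_C (prod_scale sg sh) 1 k (mu_cochain bg bh) P"

text \<open>
  An \<open>h\<close>-valued cochain is a cochain on \<open>g \<oplus> h\<close> whose values have first component \<open>0\<close>; the summand
  \<open>h\<close> of \<open>g \<oplus> h\<close> consists of the pairs with first component \<open>0\<close>.
\<close>

definition L_space ::
  "('k::field \<Rightarrow> 'g::ab_group_add \<Rightarrow> 'g) \<Rightarrow> ('k \<Rightarrow> 'h::ab_group_add \<Rightarrow> 'h) \<Rightarrow>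
   nat \<Rightarrow> (('g \<times> 'h) list \<Rightarrow> 'g \<times> 'h) set" where
  "L_space sg sh k = {P \<in> cochains (prod_scale sg sh) k.
     (\<forall>xs. fst (P xs) = 0) \<and>
     (\<forall>xs. length xs = k + 1 \<longrightarrow> (\<forall>e\<in>set xs. fst e = 0) \<longrightarrow> P xs = 0)}"

definition MC_L ::
  "('k::field \<Rightarrow> 'g::ab_group_add \<Rightarrow> 'g) \<Rightarrow> ('g \<Rightarrow> 'g \<Rightarrow> 'g) \<Rightarrow>
   ('k \<Rightarrow> 'h::ab_group_add \<Rightarrow> 'h) \<Rightarrow> ('h \<Rightarrow> 'h \<Rightarrow> 'h) \<Rightarrow> (('g \<times> 'h) list \<Rightarrow> 'g \<times> 'h) set" where
  "MC_L sg bg sh bh = {c \<in> L_space sg sh 1. \<forall>xs.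
     dbar sg bg sh bh 1 c xs
       + prod_scale sg sh (1 / 2) (bracket_C (prod_scale sg sh) 1 1 c c xs) = 0}"

definition omega_cochain ::
  "('g \<Rightarrow> 'g \<Rightarrow> 'h) \<Rightarrow> ('g::ab_group_add \<times> 'h::ab_group_add) list \<Rightarrow> 'g \<times> 'h" where
  "omega_cochain \<omega> = cochain_of_binop (\<lambda>(x, \<alpha>) (y, \<beta>). (0, \<omega> x y))"

definition l_cochain ::
  "('g \<Rightarrow> 'h \<Rightarrow> 'h) \<Rightarrow> ('g::ab_group_add \<times> 'h::ab_group_add) list \<Rightarrow> 'g \<times> 'h" where
  "l_cochain l = cochain_of_binop (\<lambda>(x, \<alpha>) (y, \<beta>). (0, l x \<beta>))"

definition r_cochain ::
  "('g \<Rightarrow> 'h \<Rightarrow> 'h) \<Rightarrow> ('g::ab_group_add \<times> 'h::ab_group_add) list \<Rightarrow> 'g \<times> 'h" where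
  "r_cochain r = cochain_of_binop (\<lambda>(x, \<alpha>) (y, \<beta>). (0, r y \<alpha>))"

end

theory Submission
  imports Defs
begin

text \<open>
  Write \<open>\<mu>\<close> for the bracket of the direct sum \<open>g \<oplus> h\<close>, \<open>c = \<omega> + l + r\<close>, and \<open>B = \<mu> + c\<close>, which is the
  extension bracket.  For binary operations \<open>P\<close> and \<open>Q\<close> the shuffle formula for \<open>P \<circ> Q\<close> has
  only three terms, collected in \<open>binop_insertion\<close> below, and \<open>B \<circ> B = 0\<close> is exactly the left
  Leibniz identity of \<open>B\<close>.  In degree one the graded bracket is the symmetric expression
  \<open>P \<circ> Q + Q \<circ> P\<close>, so after cancelling the factor two (here the characteristic enters)
  \<open>\<partial>c + [c, c] / 2 = \<mu> \<circ> c + c \<circ> \<mu> + c \<circ> c = B \<circ> B - \<mu> \<circ> \<mu> = B \<circ> B\<close>;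
  the last equality holds because \<open>\<mu>\<close> is itself a Leibniz bracket.  Hence the Maurer--Cartan
  equation for \<open>c\<close> and the Leibniz identity for \<open>B\<close> are the same equation
  (\<open>maurer_cartan_eq_leibniz_defect\<close>).

  The remaining clauses of both statements are automatic.  The cochain \<open>c\<close> lies in \<open>L\<^sub>1\<close> because each
  of its three parts is bilinear, takes values in \<open>h\<close> and uses at least one \<open>g\<close>-component
  (\<open>twist_cochain_in_L_space\<close>).  The inclusion of \<open>h\<close> and the projection to \<open>g\<close> respect the
  brackets by the shape of \<open>B\<close>, so a Leibniz bracket \<open>B\<close> always yields an extension
  (\<open>ext_bracket_nonabelian_extension\<close>).
\<close>

section \<open>The circle product in degree one\<close>

text \<open>
  This is \<open>P \<circ> Q\<close> for \<open>p = q = 1\<close>: the first term is the summand \<open>k = 0\<close>, the other two are the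
  identity and the transposition in \<open>sh(1,1)\<close>, with their signs reversed by \<open>(-1)\<^sup>k\<^sup>q = -1\<close>.
\<close>

definition binop_insertion :: "('e \<Rightarrow> 'e \<Rightarrow> 'e::ab_group_add) \<Rightarrow> ('e \<Rightarrow> 'e \<Rightarrow> 'e) \<Rightarrow> 'e \<Rightarrow> 'e \<Rightarrow> 'e \<Rightarrow> 'e"
  where "binop_insertion P Q u v w = P (Q u v) w - P u (Q v w) + P v (Q u w)"

lemma shuffle_perms_0_1: "shuffle_perms 0 (Suc 0) = {id}"
  by (auto simp: shuffle_perms_def lessThan_Suc strict_mono_on_def permutes_id)

lemma shuffle_perms_1_1: "shuffle_perms (Suc 0) (Suc 0) = {id, transpose 0 (Suc 0)}"
proof -
  have "\<sigma> permutes {..<2} \<longleftrightarrow> \<sigma> = id \<or> \<sigma> = transpose 0 (Suc 0)" for \<sigma> :: "nat \<Rightarrow> nat"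
    by (simp add: numeral_2_eq_2 lessThan_Suc insert_commute permutes_doubleton_iff)
  moreover have "{Suc 0..<2} = {Suc 0}" "{..<Suc 0} = {0}"
    by auto
  ultimately show ?thesis
    by (auto simp: shuffle_perms_def numeral_2_eq_2 strict_mono_on_def)
qed

lemma circ_C_binop:
  assumes "vector_space s"
  shows "circ_C s 1 1 (cochain_of_binop P) (cochain_of_binop Q) [u, v, w] = binop_insertion P Q u v w"
proof -
  interpret vector_space s by fact
  have "id \<noteq> transpose 0 (Suc 0)"
    by (metis id_apply transpose_apply_first zero_neq_one One_nat_def)
  then show ?thesis
    by (simp add: circ_C_def binop_insertion_def cochain_of_binop_def shuffle_perms_0_1
        shuffle_perms_1_1 sign_swap_id algebra_simps)
qed

text \<open>In the degree-one case, the sign in the graded bracket is \<open>(-1)\<^sup>2 = 1\<close>.\<close>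

lemma bracket_C_binop:
  assumes "vector_space s"
  shows "bracket_C s 1 1 (cochain_of_binop P) (cochain_of_binop Q) [u, v, w] =
    binop_insertion P Q u v w + binop_insertion Q P u v w"
proof -
  interpret vector_space s by fact
  show ?thesis
    unfolding bracket_C_def circ_C_binop[OF assms] by simp
qed

lemma bracket_C_degree_one_other_length: "length xs \<noteq> 3 \<Longrightarrow> vector_space s \<Longrightarrow> bracket_C s 1 1 P Q xs = 0"
  unfolding bracket_C_def circ_C_def
  by (simp add: module.scale_zero_right module_iff_vector_space[symmetric] eval_nat_numeral)

section \<open>Maurer--Cartan elements and the Leibniz identity\<close>

lemma bilinear_map_iff:
  "bilinear_map s1 s2 s3 B \<longleftrightarrow>
    vector_space s1 \<and> vector_space s2 \<and> vector_space s3 \<and>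
    (\<forall>x x' y. B (x + x') y = B x y + B x' y) \<and> (\<forall>x y y'. B x (y + y') = B x y + B x y') \<and>
    (\<forall>a x y. B (s1 a x) y = s3 a (B x y)) \<and> (\<forall>a x y. B x (s2 a y) = s3 a (B x y))"
  unfolding bilinear_map_def Vector_Spaces.linear_iff by blast

lemma bilinear_map_zero:
  assumes "bilinear_map s1 s2 s3 B"
  shows "B 0 y = 0" "B x 0 = 0"
proof -
  have "B (0 + 0) y = B 0 y + B 0 y" "B x (0 + 0) = B x 0 + B x 0"
    using assms unfolding bilinear_map_iff by blast+
  then show "B 0 y = 0" "B x 0 = 0" by simp_all
qed

lemma leibniz_algebra_iff:
  "leibniz_algebra s B \<longleftrightarrow> bilinear_map s s s B \<and> (\<forall>u v w. binop_insertion B B u v w = 0)"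
proof -
  have "B u (B v w) = B (B u v) w + B v (B u w) \<longleftrightarrow> binop_insertion B B u v w = 0" for u v w
    unfolding binop_insertion_def by (auto simp: algebra_simps)
  then show ?thesis
    unfolding leibniz_algebra_def leibniz_algebra_axioms_def by (auto simp: bilinear_map_iff)
qed

text \<open>
  Polarisation of the quadratic expression \<open>P \<circ> P\<close>: the bracket with \<open>M\<close> supplies the mixed terms of
  \<open>(M + C) \<circ> (M + C)\<close>, and half of \<open>[C, C]\<close> supplies \<open>C \<circ> C\<close>.
\<close>

lemma maurer_cartan_eq_leibniz_defect:
  fixes s :: "'k::field \<Rightarrow> 'e::ab_group_add \<Rightarrow> 'e"
  assumes M: "bilinear_map s s s M" and C: "bilinear_map s s s C" and two: "(2::'k) \<noteq> 0"
  shows "bracket_C s 1 1 (cochain_of_binop M) (cochain_of_binop C) [u, v, w] +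
      s (1 / 2) (bracket_C s 1 1 (cochain_of_binop C) (cochain_of_binop C) [u, v, w]) =
    binop_insertion (\<lambda>u v. M u v + C u v) (\<lambda>u v. M u v + C u v) u v w - binop_insertion M M u v w"
proof -
  have vs: "vector_space s" using M by (simp add: bilinear_map_iff)
  interpret vector_space s by (fact vs)
  have half: "s (1 / 2) (x + x) = x" for x
  proof -
    have "s (1 / 2) (x + x) = s (1 / 2 + 1 / 2) x"
      by (simp only: scale_left_distrib scale_right_distrib)
    also have "1 / 2 + 1 / 2 = (1::'k)" using two by (simp add: field_simps)
    finally show ?thesis by simp
  qed
  have add: "M (x + x') y = M x y + M x' y" "M x (y + y') = M x y + M x y'"
    "C (x + x') y = C x y + C x' y" "C x (y + y') = C x y + C x y'" for x x' y y'
    using M C by (auto simp: bilinear_map_iff)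
  show ?thesis
    unfolding bracket_C_binop[OF vs] half
    by (simp add: binop_insertion_def add algebra_simps)
qed

lemma cochain_of_binop_in_cochains:
  assumes "bilinear_map s s s B"
  shows "cochain_of_binop B \<in> cochains s 1"
proof -
  have "Vector_Spaces.linear s s (\<lambda>x. cochain_of_binop B (xs[i := x]))"
    if "length xs = 2" "i < 2" for xs i
  proof -
    obtain u v where xs: "xs = [u, v]"
      using \<open>length xs = 2\<close> by (auto simp: numeral_2_eq_2 length_Suc_conv)
    from \<open>i < 2\<close> have "i = 0 \<or> i = 1" by auto
    then show ?thesis
      using assms by (auto simp: xs cochain_of_binop_def bilinear_map_def)
  qed
  moreover have "cochain_of_binop B xs = 0" if "length xs \<noteq> 2" for xs
    using that by (auto simp: cochain_of_binop_def split: list.split)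
  ultimately show ?thesis
    by (simp add: cochains_def numeral_2_eq_2)
qed

section \<open>The extension bracket as a perturbation of the direct sum bracket\<close>

definition direct_sum_bracket ::
  "('g \<Rightarrow> 'g \<Rightarrow> 'g) \<Rightarrow> ('h \<Rightarrow> 'h \<Rightarrow> 'h) \<Rightarrow> 'g \<times> 'h \<Rightarrow> 'g \<times> 'h \<Rightarrow> 'g \<times> 'h" where
  "direct_sum_bracket bg bh u v = (bg (fst u) (fst v), bh (snd u) (snd v))"

definition twist ::
  "('g \<Rightarrow> 'h \<Rightarrow> 'h) \<Rightarrow> ('g \<Rightarrow> 'h \<Rightarrow> 'h) \<Rightarrow> ('g \<Rightarrow> 'g \<Rightarrow> 'h) \<Rightarrow>
   'g \<times> 'h \<Rightarrow> 'g \<times> 'h \<Rightarrow> 'g::ab_group_add \<times> 'h::ab_group_add" where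
  "twist l r \<omega> u v = (0, \<omega> (fst u) (fst v) + l (fst u) (snd v) + r (fst v) (snd u))"

lemma ext_bracket_eq:
  "ext_bracket bg bh l r \<omega> = (\<lambda>u v. direct_sum_bracket bg bh u v + twist l r \<omega> u v)"
  by (auto simp: fun_eq_iff ext_bracket_def direct_sum_bracket_def twist_def algebra_simps)

lemma mu_cochain_eq: "mu_cochain bg bh = cochain_of_binop (direct_sum_bracket bg bh)"
  by (simp add: mu_cochain_def direct_sum_bracket_def[abs_def] case_prod_unfold)

lemma twist_cochain_eq:
  "(\<lambda>xs. omega_cochain \<omega> xs + l_cochain l xs + r_cochain r xs) = cochain_of_binop (twist l r \<omega>)"
  by (auto simp: fun_eq_iff omega_cochain_def l_cochain_def r_cochain_def cochain_of_binop_def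
      twist_def split: list.split)

lemma vector_space_prod_scale:
  assumes "vector_space sg" "vector_space sh"
  shows "vector_space (prod_scale sg sh)"
proof -
  interpret vector_space_prod sg sh
    using assms by (simp add: vector_space_prod_def vector_space_pair_def)
  show ?thesis by (fact p.vector_space_axioms)
qed

lemma prod_scale_apply:
  assumes "vector_space sg" "vector_space sh"
  shows "prod_scale sg sh a u = (sg a (fst u), sh a (snd u))"
proof -
  interpret vector_space_prod sg sh
    using assms by (simp add: vector_space_prod_def vector_space_pair_def)
  show ?thesis by (fact scale_def)
qed

lemma bilinear_direct_sum_bracket:
  assumes "bilinear_map sg sg sg bg" "bilinear_map sh sh sh bh"
  shows "bilinear_map (prod_scale sg sh) (prod_scale sg sh) (prod_scale sg sh) (direct_sum_bracket bg bh)"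
  using assms
  by (auto simp: bilinear_map_iff vector_space_prod_scale prod_scale_apply direct_sum_bracket_def)

lemma direct_sum_leibniz_algebra:
  assumes "leibniz_algebra sg bg" "leibniz_algebra sh bh"
  shows "leibniz_algebra (prod_scale sg sh) (direct_sum_bracket bg bh)"
  using assms bilinear_direct_sum_bracket[of sg bg sh bh]
  by (auto simp: leibniz_algebra_iff binop_insertion_def direct_sum_bracket_def zero_prod_def)

lemma bilinear_twist:
  assumes "vector_space sg" "vector_space sh"
    and "bilinear_map sg sh sh l" "bilinear_map sg sh sh r" "bilinear_map sg sg sh \<omega>"
  shows "bilinear_map (prod_scale sg sh) (prod_scale sg sh) (prod_scale sg sh) (twist l r \<omega>)"
proof -
  interpret g: vector_space sg by fact
  interpret h: vector_space sh by fact
  show ?thesis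
    using assms
    by (auto simp: bilinear_map_iff vector_space_prod_scale prod_scale_apply twist_def
        h.scale_right_distrib algebra_simps)
qed

text \<open>
  The condition defining \<open>L\<close> excludes exactly a component \<open>h \<otimes> h \<rightarrow> h\<close>; each of \<open>\<omega>\<close>, \<open>l\<close>, \<open>r\<close> has an
  argument from \<open>g\<close>, which is zero on elements of \<open>h\<close>.
\<close>

lemma twist_cochain_in_L_space:
  assumes "vector_space sg" "vector_space sh"
    and "bilinear_map sg sh sh l" "bilinear_map sg sh sh r" "bilinear_map sg sg sh \<omega>"
  shows "cochain_of_binop (twist l r \<omega>) \<in> L_space sg sh 1"
proof -
  note zero = bilinear_map_zero[OF assms(3)] bilinear_map_zero[OF assms(4)]
    bilinear_map_zero[OF assms(5)]
  have "fst (cochain_of_binop (twist l r \<omega>) xs) = 0" for xs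
    by (simp add: cochain_of_binop_def twist_def split: list.split)
  moreover have "cochain_of_binop (twist l r \<omega>) xs = 0" if "\<forall>e\<in>set xs. fst e = 0" for xs
    using that
    by (auto simp: cochain_of_binop_def twist_def zero_prod_def zero split: list.split)
  ultimately show ?thesis
    using cochain_of_binop_in_cochains[OF bilinear_twist[OF assms]]
    by (simp add: L_space_def)
qed

lemma ext_bracket_nonabelian_extension:
  assumes g: "leibniz_algebra sg bg" and h: "leibniz_algebra sh bh"
    and l: "bilinear_map sg sh sh l" and r: "bilinear_map sg sh sh r"
    and \<omega>: "bilinear_map sg sg sh \<omega>"
    and e: "leibniz_algebra (prod_scale sg sh) (ext_bracket bg bh l r \<omega>)"
  shows "nonabelian_extension sg bg sh bh (prod_scale sg sh) (ext_bracket bg bh l r \<omega>)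
    (\<lambda>\<alpha>. (0, \<alpha>)) fst"
proof -
  interpret g: leibniz_algebra sg bg by fact
  interpret h: leibniz_algebra sh bh by fact
  have vs: "vector_space sg" "vector_space sh"
    by (fact g.vector_space_axioms) (fact h.vector_space_axioms)
  note zero = bilinear_map_zero[OF l] bilinear_map_zero[OF r] bilinear_map_zero[OF \<omega>]
    bilinear_map_zero[OF g.bilinear_bracket]
  have "leibniz_hom sh bh (prod_scale sg sh) (ext_bracket bg bh l r \<omega>) (\<lambda>\<alpha>. (0, \<alpha>))"
    using vs by (auto simp: leibniz_hom_def Vector_Spaces.linear_iff vector_space_prod_scale
        prod_scale_apply ext_bracket_def zero)
  moreover have "leibniz_hom (prod_scale sg sh) (ext_bracket bg bh l r \<omega>) sg bg fst"
    using vs by (auto simp: leibniz_hom_def Vector_Spaces.linear_iff vector_space_prod_scale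
        prod_scale_apply ext_bracket_def)
  moreover have "range (\<lambda>\<alpha>. (0, \<alpha>)) = {e :: 'b \<times> 'c. fst e = 0}"
    by (auto simp: image_iff)
  ultimately show ?thesis
    using g h e by (simp add: nonabelian_extension_def inj_on_def surj_def)
qed

lemma two_neq_zero_if_CHAR_neq_2:
  assumes "CHAR('k::field) \<noteq> 2"
  shows "(2::'k) \<noteq> 0"
proof
  assume "(2::'k) = 0"
  then have "of_nat 2 = (0::'k)" by simp
  then have "CHAR('k) dvd 2" by (simp only: of_nat_eq_0_iff_char_dvd)
  then have "CHAR('k) = 1 \<or> CHAR('k) = 2"
    using two_is_prime_nat by (auto simp: prime_nat_iff)
  with assms show False by simp
qed

theorem proposition4p5:
  fixes sg :: "'k::field \<Rightarrow> 'g::ab_group_add \<Rightarrow> 'g"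
    and bg :: "'g \<Rightarrow> 'g \<Rightarrow> 'g"
    and sh :: "'k \<Rightarrow> 'h::ab_group_add \<Rightarrow> 'h"
    and bh :: "'h \<Rightarrow> 'h \<Rightarrow> 'h"
    and l r :: "'g \<Rightarrow> 'h \<Rightarrow> 'h"
    and \<omega> :: "'g \<Rightarrow> 'g \<Rightarrow> 'h"
  assumes "CHAR('k) \<noteq> 2"
    and "leibniz_algebra sg bg"
    and "leibniz_algebra sh bh"
    and "bilinear_map sg sh sh l"
    and "bilinear_map sg sh sh r"
    and "bilinear_map sg sg sh \<omega>"
  shows "(leibniz_algebra (prod_scale sg sh) (ext_bracket bg bh l r \<omega>) \<and>
          nonabelian_extension sg bg sh bh
            (prod_scale sg sh) (ext_bracket bg bh l r \<omega>) (\<lambda>\<alpha>. (0, \<alpha>)) fst)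
     \<longleftrightarrow> (\<lambda>xs. omega_cochain \<omega> xs + l_cochain l xs + r_cochain r xs) \<in> MC_L sg bg sh bh"
proof -
  let ?s = "prod_scale sg sh" and ?B = "ext_bracket bg bh l r \<omega>"
  let ?M = "direct_sum_bracket bg bh" and ?C = "twist l r \<omega>"
  let ?MC = "\<lambda>xs. bracket_C ?s 1 1 (cochain_of_binop ?M) (cochain_of_binop ?C) xs +
    ?s (1 / 2) (bracket_C ?s 1 1 (cochain_of_binop ?C) (cochain_of_binop ?C) xs)"
  have vs: "vector_space sg" "vector_space sh"
    using assms(2,3) by (auto simp: leibniz_algebra_def)
  interpret p: vector_space ?s by (rule vector_space_prod_scale[OF vs])
  have M: "leibniz_algebra ?s ?M"
    by (rule direct_sum_leibniz_algebra[OF assms(2,3)])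
  then have bilinear_M: "bilinear_map ?s ?s ?s ?M"
    by (simp add: leibniz_algebra_iff)
  note bilinear_C = bilinear_twist[OF vs assms(4-6)]
  have bilinear_B: "bilinear_map ?s ?s ?s ?B"
    using bilinear_M bilinear_C
    unfolding ext_bracket_eq bilinear_map_iff
    by (auto simp: p.scale_right_distrib algebra_simps)
  have MC: "?MC [u, v, w] = binop_insertion ?B ?B u v w" for u v w
  proof -
    have "binop_insertion ?M ?M u v w = 0"
      using M unfolding leibniz_algebra_iff by blast
    then show ?thesis
      using maurer_cartan_eq_leibniz_defect[OF bilinear_M bilinear_C
          two_neq_zero_if_CHAR_neq_2[OF assms(1)]]
      by (simp only: ext_bracket_eq diff_0_right)
  qed
  have MC_other: "?MC xs = 0" if "length xs \<noteq> 3" for xs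
    using that by (simp only: bracket_C_degree_one_other_length[OF that p.vector_space_axioms]
        p.scale_zero_right add_0)
  have "(\<forall>xs. ?MC xs = 0) \<longleftrightarrow> (\<forall>u v w. binop_insertion ?B ?B u v w = 0)"
  proof
    assume "\<forall>xs. ?MC xs = 0"
    then show "\<forall>u v w. binop_insertion ?B ?B u v w = 0" by (metis MC)
  next
    assume defect: "\<forall>u v w. binop_insertion ?B ?B u v w = 0"
    show "\<forall>xs. ?MC xs = 0"
    proof
      fix xs :: "('g \<times> 'h) list"
      show "?MC xs = 0"
      proof (cases "length xs = 3")
        case True
        then obtain u v w where "xs = [u, v, w]"
          by (auto simp: numeral_3_eq_3 length_Suc_conv)
        then show ?thesis using MC defect by simp
      qed (rule MC_other)
    qed
  qed
  then have "cochain_of_binop ?C \<in> MC_L sg bg sh bh \<longleftrightarrow> leibniz_algebra ?s ?B"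
    using twist_cochain_in_L_space[OF vs assms(4-6)] bilinear_B
    unfolding MC_L_def dbar_def mu_cochain_eq leibniz_algebra_iff by simp
  then show ?thesis
    unfolding twist_cochain_eq using ext_bracket_nonabelian_extension[OF assms(2-6)] by blast
qed

end
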